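(* For all integers $r\ge1$ and $n\ge0$, $$|\mathrm{DUPF}^r_{n+r}|=\sum_{k\ge0}d_{k+r}\,S_r(n+r,k+r).$$
   Context: $[n]=\{1,\dots,n\}$; $d_k$ is the number of derangements of $[k]$. $S_r(n+r,k+r)$ is the $r$-Stirling number of the second kind: the number of partitions of $[n+r]$ into $k+r$ nonempty blocks with $1,\dots,r$ in pairwise distinct blocks. A tuple $\alpha=(a_1,\dots,a_N)\in[N]^N$ is a parking function if, when cars $1,\dots,N$ enter in this order a one-way street with spots $1,\dots,N$ and car $i$ parks in the first free spot $s_i\ge a_i$, all cars manage to park. $\mathrm{UPF}_N$ (unit-interval parking functions) is the set of parking functions of length $N$ with $s_i-a_i\in\{0,1\}$ for all $i$. Block structure: for $\alpha\in\mathrm{UPF}_N$ let $(a^\uparrow_1,\dots,a^\uparrow_N)$ be its weakly increasing rearrangement, let $\nu_1<\dots<\nu_m$ be the indices $i$ with $a^\uparrow_i=i$, and put $\nu_{m+1}=N+1$. The car set of block $j$ is $I_j=\{i\in[N]:\nu_j\le a_i<\nu_{j+1}\}$. Set $\phi(\alpha)=(I_1,\dots,I_m)$, an ordered set partition of $[N]$. An ordered set partition $(C_1,\dots,C_k)$ of $[N]$, whose blocks listed by increasing minimum element are $B_1,\dots,B_k$, is deranged if $C_i\ne B_i$ for all $i\in[k]$. $\mathrm{DUPF}^r_{n+r}$ is the set of $\alpha\in\mathrm{UPF}_{n+r}$ whose first $r$ entries $a_1,\dots,a_r$ are pairwise distinct and for which $\phi(\alpha)$ is deranged. *)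

theory Defs
  imports Complex_Main "HOL-Library.FuncSet" "HOL-Library.Disjoint_Sets"
    "HOL-Combinatorics.Permutations"
begin

text \<open>Tuples \<open>(a\<^sub>1, \<dots>, a\<^sub>N)\<close> in \<open>[N]\<^sup>N\<close> are extensional functions on \<open>{1..N}\<close>.\<close>

definition tuples :: "nat \<Rightarrow> (nat \<Rightarrow> nat) set" where
  "tuples N = {1..N} \<rightarrow>\<^sub>E {1..N}"

text \<open>The spot taken by car \<open>i\<close> on a street with spots \<open>1, \<dots>, N\<close>; \<open>None\<close> means that the
  car finds no free spot and leaves the street.\<close>

function park :: "nat \<Rightarrow> (nat \<Rightarrow> nat) \<Rightarrow> nat \<Rightarrow> nat option" where
  "park N \<alpha> i =
    (let F = {s \<in> {1..N}. \<alpha> i \<le> s \<and> Some s \<notin> park N \<alpha> ` {1..<i}}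
     in if F = {} then None else Some (Min F))"
  by auto
termination
  by (relation "measure (\<lambda>(N, \<alpha>, i). i)") auto

text \<open>The defining equation always unfolds, so it must not be a default rewrite rule.\<close>

declare park.simps [simp del]

definition parking_functions :: "nat \<Rightarrow> (nat \<Rightarrow> nat) set" where
  "parking_functions N = {\<alpha> \<in> tuples N. \<forall>i\<in>{1..N}. park N \<alpha> i \<noteq> None}"

definition UPF :: "nat \<Rightarrow> (nat \<Rightarrow> nat) set" where
  "UPF N = {\<alpha> \<in> parking_functions N.
     \<forall>i\<in>{1..N}. int (the (park N \<alpha> i)) - int (\<alpha> i) \<in> {0, 1}}"

text \<open>Lists are indexed from 0, so \<open>a\<^sup>\<up>\<^sub>i\<close> is \<open>rearrangement N \<alpha> ! (i - 1)\<close>,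
  and \<open>\<nu>\<^sub>j\<close> is \<open>cuts N \<alpha> ! (j - 1)\<close>, where \<open>cuts N \<alpha>\<close> includes the
  final entry \<open>\<nu>\<^sub>m\<^sub>+\<^sub>1 = N + 1\<close>.\<close>

definition rearrangement :: "nat \<Rightarrow> (nat \<Rightarrow> nat) \<Rightarrow> nat list" where
  "rearrangement N \<alpha> = sort (map \<alpha> [1..<N + 1])"

definition cuts :: "nat \<Rightarrow> (nat \<Rightarrow> nat) \<Rightarrow> nat list" where
  "cuts N \<alpha> = sorted_list_of_set {i \<in> {1..N}. rearrangement N \<alpha> ! (i - 1) = i} @ [N + 1]"

definition phi :: "nat \<Rightarrow> (nat \<Rightarrow> nat) \<Rightarrow> nat set list" where
  "phi N \<alpha> = map (\<lambda>j. {i \<in> {1..N}. cuts N \<alpha> ! j \<le> \<alpha> i \<and> \<alpha> i < cuts N \<alpha> ! (j + 1)})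
     [0..<length (cuts N \<alpha>) - 1]"

definition ordered_set_partition :: "nat \<Rightarrow> nat set list \<Rightarrow> bool" where
  "ordered_set_partition N Cs \<longleftrightarrow> distinct Cs \<and> partition_on {1..N} (set Cs)"

definition deranged :: "nat \<Rightarrow> nat set list \<Rightarrow> bool" where
  "deranged N Cs \<longleftrightarrow> ordered_set_partition N Cs \<and>
     (\<forall>i < length Cs. Cs ! i \<noteq> sort_key Min Cs ! i)"

definition DUPF :: "nat \<Rightarrow> nat \<Rightarrow> (nat \<Rightarrow> nat) set" where
  "DUPF r N = {\<alpha> \<in> UPF N. inj_on \<alpha> {1..r} \<and> deranged N (phi N \<alpha>)}"

definition derangement_number :: "nat \<Rightarrow> nat" where
  "derangement_number k = card {p. p permutes {1..k} \<and> (\<forall>i\<in>{1..k}. p i \<noteq> i)}"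

text \<open>Here \<open>N\<close> and \<open>K\<close> are the shifted arguments \<open>n + r\<close> and \<open>k + r\<close>
  of \<open>S\<^sub>r(n + r, k + r)\<close>.\<close>

definition r_stirling :: "nat \<Rightarrow> nat \<Rightarrow> nat \<Rightarrow> nat" where
  "r_stirling r N K = card {P. partition_on {1..N} P \<and> card P = K \<and>
     (\<forall>i\<in>{1..r}. \<forall>j\<in>{1..r}. i \<noteq> j \<longrightarrow> \<not> (\<exists>B\<in>P. i \<in> B \<and> j \<in> B))}"

end

theory Submission
  imports Defs
begin

text \<open>Call a car lucky if it parks in its preferred spot; in a unit-interval parking function every
  other car parks one spot further. The cuts \<open>\<nu>\<^sub>j\<close> are exactly the spots of the lucky cars, so block
  \<open>j\<close> is the set of cars parked in \<open>[\<nu>\<^sub>j, \<nu>\<^sub>j\<^sub>+\<^sub>1)\<close>, and these cars stand there in increasing order.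
  Hence the ordered set partition determines all spots, and \<open>phi\<close> is a bijection onto the ordered set
  partitions. Within a block only the two earliest cars share a preference, so the first \<open>r\<close>
  entries are distinct iff \<open>1, \<dots>, r\<close> lie in distinct blocks. Finally, a set partition with \<open>K\<close>
  blocks has \<open>d\<^sub>K\<close> deranged orderings.\<close>

section \<open>Parking outcomes described by injective spot assignments\<close>

text \<open>\<open>s\<close> assigns to each car its spot; these conditions characterise the outcome of parking.\<close>

definition unit_spots :: "nat \<Rightarrow> (nat \<Rightarrow> nat) \<Rightarrow> (nat \<Rightarrow> nat) \<Rightarrow> bool" where
  "unit_spots N \<alpha> s \<longleftrightarrow> inj_on s {1..N} \<and> s ` {1..N} \<subseteq> {1..N} \<and>
     (\<forall>i\<in>{1..N}. s i = \<alpha> i \<or> (s i = Suc (\<alpha> i) \<and> (\<exists>j\<in>{1..<i}. s j = \<alpha> i)))"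

definition lucky_spots :: "nat \<Rightarrow> (nat \<Rightarrow> nat) \<Rightarrow> (nat \<Rightarrow> nat) \<Rightarrow> nat set" where
  "lucky_spots N \<alpha> s = {x. \<exists>i\<in>{1..N}. s i = x \<and> \<alpha> i = x}"

lemma park_eq_spots:
  assumes "unit_spots N \<alpha> s" "i \<in> {1..N}"
  shows "park N \<alpha> i = Some (s i)"
  using assms(2)
proof (induction i rule: less_induct)
  case (less i)
  define F where "F = {x \<in> {1..N}. \<alpha> i \<le> x \<and> Some x \<notin> park N \<alpha> ` {1..<i}}"
  have im: "park N \<alpha> ` {1..<i} = Some ` s ` {1..<i}"
    unfolding image_image using less by (intro image_cong) auto
  have inj: "inj_on s {1..N}" and ran: "s i \<in> {1..N}"
    and disp: "s i = \<alpha> i \<or> (s i = Suc (\<alpha> i) \<and> (\<exists>j\<in>{1..<i}. s j = \<alpha> i))"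
    using assms(1) less.prems unfolding unit_spots_def by blast+
  have "s i \<notin> s ` {1..<i}"
    using inj less.prems by (auto dest!: inj_onD)
  then have memF: "s i \<in> F"
    using ran disp unfolding F_def im by auto
  \<comment> \<open>By induction the occupied spots are the values of \<open>s\<close> at earlier
    cars. The only candidate below \<open>s i\<close> is the preferred spot of an unlucky car, and
    an earlier car occupies it.\<close>
  have "s i \<le> x" if "x \<in> F" for x
  proof (rule ccontr)
    assume "\<not> s i \<le> x"
    then have "s i = Suc (\<alpha> i)" "x = \<alpha> i" "\<exists>j\<in>{1..<i}. s j = \<alpha> i"
      using disp that unfolding F_def by auto
    then show False
      using that unfolding F_def im by (metis (no_types, lifting) image_eqI mem_Collect_eq)
  qed
  then have "Min F = s i"
    using memF by (intro Min_eqI) (auto simp: F_def)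
  then show ?case
    unfolding park.simps[of N \<alpha> i] F_def[symmetric] Let_def using memF by auto
qed

text \<open>Each car takes the least free spot at or beyond its preference. If it lands one further,
  its preferred spot was not free, so an earlier car holds it. Distinctness of spots follows because
  a car avoids every spot already taken.\<close>

lemma unit_spots_of_UPF:
  assumes "\<alpha> \<in> UPF N"
  shows "unit_spots N \<alpha> (\<lambda>i. the (park N \<alpha> i))"
proof -
  define F where "F = (\<lambda>i. {x \<in> {1..N}. \<alpha> i \<le> x \<and> Some x \<notin> park N \<alpha> ` {1..<i}})"
  define s where "s = (\<lambda>i. the (park N \<alpha> i))"
  have park: "park N \<alpha> i = Some (s i)" "s i = \<alpha> i \<or> s i = Suc (\<alpha> i)" "\<alpha> i \<in> {1..N}"
    if "i \<in> {1..N}" for i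
    using assms that unfolding UPF_def parking_functions_def tuples_def s_def by fastforce+
  have sF: "s i \<in> F i" "s i = Min (F i)" if "i \<in> {1..N}" for i
  proof -
    have *: "F i \<noteq> {} \<and> s i = Min (F i)"
      using park(1)[OF that] by (subst (asm) park.simps) (auto simp: Let_def F_def split: if_splits)
    moreover have "finite (F i)"
      by (simp add: F_def)
    ultimately show "s i \<in> F i" "s i = Min (F i)"
      using Min_in by auto
  qed
  have ne: "s j \<noteq> s i" if "i \<in> {1..N}" "j \<in> {1..<i}" for i j
    using sF(1)[OF that(1)] park(1)[of j] that unfolding F_def by force
  have "inj_on s {1..N}"
    by (rule linorder_inj_onI) (use ne in auto)
  moreover have "s ` {1..N} \<subseteq> {1..N}"
    using sF(1) unfolding F_def by blast
  moreover have "\<exists>j\<in>{1..<i}. s j = \<alpha> i" if i: "i \<in> {1..N}" and "s i = Suc (\<alpha> i)" for i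
  proof -
    have "finite (F i)"
      by (simp add: F_def)
    then have "\<alpha> i \<notin> F i"
      using sF(2)[OF i] that(2) Min_le[of "F i" "\<alpha> i"] by linarith
    then have "Some (\<alpha> i) \<in> park N \<alpha> ` {1..<i}"
      using park(3)[OF i] by (auto simp: F_def)
    then show ?thesis
      using park(1) i by force
  qed
  ultimately show ?thesis
    using park(2) unfolding unit_spots_def s_def by blast
qed

lemma UPF_of_unit_spots:
  assumes "unit_spots N \<alpha> s" "\<alpha> \<in> extensional {1..N}"
  shows "\<alpha> \<in> UPF N"
proof -
  have "\<alpha> i \<in> {1..N} \<and> int (s i) - int (\<alpha> i) \<in> {0, 1}" if "i \<in> {1..N}" for i
  proof -
    \<comment> \<open>For an unlucky car, \<open>s i = Suc (\<alpha> i)\<close> alone would allow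
      preference 0; positivity comes from \<open>\<alpha> i\<close> being the spot of an earlier
      car.\<close>
    have "s j \<in> {1..N}" if "j \<in> {1..N}" for j
      using assms(1) that unfolding unit_spots_def by blast
    moreover have "s i = \<alpha> i \<or> (s i = Suc (\<alpha> i) \<and> (\<exists>j\<in>{1..<i}. s j = \<alpha> i))"
      using assms(1) that unfolding unit_spots_def by blast
    ultimately show ?thesis
      using that by fastforce
  qed
  then show ?thesis
    using assms(2) park_eq_spots[OF assms(1)]
    unfolding UPF_def parking_functions_def tuples_def PiE_def Pi_def by auto
qed

lemma unit_spots_bij:
  assumes "unit_spots N \<alpha> s"
  shows "bij_betw s {1..N} {1..N}"
  using assms unfolding unit_spots_def bij_betw_def
  by (metis card_image card_subset_eq finite_atLeastAtMost)

text \<open>Every spot is taken by exactly one car, so counting cars reduces to counting spots. This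
  yields both the order statistics of the preferences and the block sizes.\<close>

lemma card_cars_in_spots:
  assumes "unit_spots N \<alpha> s" "B \<subseteq> {1..N}"
  shows "card {k \<in> {1..N}. s k \<in> B} = card B"
proof -
  have "bij_betw s {k \<in> {1..N}. s k \<in> B} B"
  proof (rule bij_betw_subset[OF unit_spots_bij[OF assms(1)]])
    have "s ` {k \<in> {1..N}. s k \<in> B} = B \<inter> s ` {1..N}" by blast
    then show "s ` {k \<in> {1..N}. s k \<in> B} = B"
      using bij_betw_imp_surj_on[OF unit_spots_bij[OF assms(1)]] assms(2) by (metis Int_absorb2)
  qed blast
  then show ?thesis
    by (rule bij_betw_same_card)
qed

section \<open>Order statistics and the cuts\<close>

lemma sorted_nth_le_iff:
  fixes xs :: "'a::linorder list"
  assumes "sorted xs" "k < length xs"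
  shows "xs ! k \<le> y \<longleftrightarrow> k < length (filter (\<lambda>x. x \<le> y) xs)"
  using assms
proof (induction xs arbitrary: k)
  case (Cons x xs)
  show ?case
  proof (cases "x \<le> y")
    case True
    then show ?thesis using Cons by (cases k) auto
  next
    case False
    then have "\<forall>z\<in>set (x # xs). \<not> z \<le> y"
      using Cons.prems(1) by auto
    then have "filter (\<lambda>z. z \<le> y) (x # xs) = []" "\<not> (x # xs) ! k \<le> y"
      using Cons.prems(2) nth_mem by (blast intro: filter_False)+
    then show ?thesis by simp
  qed
qed simp

text \<open>In a sorted list the entries at most \<open>y\<close> form an initial segment, and
  sorting does not change how many there are.\<close>

lemma rearrangement_le_iff:
  assumes "i \<in> {1..N}"
  shows "rearrangement N \<alpha> ! (i - 1) \<le> y \<longleftrightarrow> i \<le> card {k \<in> {1..N}. \<alpha> k \<le> y}"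
proof -
  have "length (filter (\<lambda>x. x \<le> y) (rearrangement N \<alpha>))
      = length (filter (\<lambda>x. x \<le> y) (map \<alpha> [1..<N + 1]))"
    unfolding rearrangement_def by (metis mset_filter mset_sort size_mset)
  also have "\<dots> = length (filter (\<lambda>k. \<alpha> k \<le> y) [1..<N + 1])"
    by (simp add: filter_map comp_def del: upt_Suc)
  also have "\<dots> = card {k \<in> {1..N}. \<alpha> k \<le> y}"
    by (subst distinct_length_filter) (auto intro!: arg_cong[of _ _ card])
  finally have "length (filter (\<lambda>x. x \<le> y) (rearrangement N \<alpha>))
      = card {k \<in> {1..N}. \<alpha> k \<le> y}" .
  moreover have "sorted (rearrangement N \<alpha>)" "i - 1 < length (rearrangement N \<alpha>)"
    using assms by (auto simp: rearrangement_def simp del: upt_Suc)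
  moreover have "i - 1 < c \<longleftrightarrow> i \<le> c" for c
    using assms by (cases i) auto
  ultimately show ?thesis
    using sorted_nth_le_iff by metis
qed

text \<open>Cars with preference at most \<open>y\<close> are those parked in \<open>{1..y}\<close>, together with the car
  parked at \<open>y + 1\<close> if that car is unlucky.\<close>

lemma rearrangement_fixed_iff:
  assumes us: "unit_spots N \<alpha> s" and i: "i \<in> {1..N}"
  shows "rearrangement N \<alpha> ! (i - 1) = i \<longleftrightarrow> i \<in> lucky_spots N \<alpha> s"
proof -
  have disp: "s k = \<alpha> k \<or> s k = Suc (\<alpha> k)" if "k \<in> {1..N}" for k
    using us that unfolding unit_spots_def by blast
  have range: "s k \<in> {1..N}" if "k \<in> {1..N}" for k
    using us that unfolding unit_spots_def by blast
  have inj: "inj_on s {1..N}"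
    using us unfolding unit_spots_def by blast
  obtain k where k: "k \<in> {1..N}" "s k = i"
    using unit_spots_bij[OF us] i unfolding bij_betw_def by (metis imageE)
  have lucky: "i \<in> lucky_spots N \<alpha> s \<longleftrightarrow> \<alpha> k = i"
    using k inj unfolding lucky_spots_def by (auto dest: inj_onD)
  have below: "card {k \<in> {1..N}. s k \<in> {1..y}} = y" if "y \<le> N" for y
    using card_cars_in_spots[OF us, of "{1..y}"] that by simp
  have "i \<le> card {k \<in> {1..N}. \<alpha> k \<le> i}"
  proof -
    have "card {k \<in> {1..N}. s k \<in> {1..i}} \<le> card {k \<in> {1..N}. \<alpha> k \<le> i}"
      using disp by (intro card_mono) force+
    then show ?thesis using below[of i] i by simp
  qed
  then have le: "rearrangement N \<alpha> ! (i - 1) \<le> i"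
    using rearrangement_le_iff[OF i] by simp
  \<comment> \<open>Given \<open>le\<close>, the entry equals \<open>i\<close> unless it is at most
    \<open>i - 1\<close>, and that case is decided by counting preferences up to
    \<open>i - 1\<close>.\<close>
  have "i \<le> card {k \<in> {1..N}. \<alpha> k \<le> i - 1} \<longleftrightarrow> \<alpha> k \<noteq> i"
  proof (cases "\<alpha> k = i")
    case True
    have "s j \<in> {1..i - 1}" if "j \<in> {1..N}" "\<alpha> j \<le> i - 1" for j
    proof -
      have "j \<noteq> k" using True that i by auto
      then have "s j \<noteq> i" using inj k that(1) by (auto dest: inj_onD)
      then show ?thesis using disp[OF that(1)] range[OF that(1)] that(2) i by fastforce
    qed
    then have "card {k \<in> {1..N}. \<alpha> k \<le> i - 1} \<le> card {k \<in> {1..N}. s k \<in> {1..i - 1}}"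
      by (intro card_mono) auto
    also have "\<dots> = i - 1"
      using i by (intro below) auto
    finally show ?thesis using True i by auto
  next
    case False
    have "s j \<le> i \<Longrightarrow> \<alpha> j \<le> i - 1" if "j \<in> {1..N}" for j
      using False disp[OF that] k inj_onD[OF inj, of j k] that by fastforce
    then have "card {k \<in> {1..N}. s k \<in> {1..i}} \<le> card {k \<in> {1..N}. \<alpha> k \<le> i - 1}"
      by (intro card_mono) auto
    then show ?thesis using False below[of i] i by simp
  qed
  then show ?thesis
    using le rearrangement_le_iff[OF i, of \<alpha> "i - 1"] lucky i by auto
qed

lemma cuts_eq:
  assumes "unit_spots N \<alpha> s"
  shows "cuts N \<alpha> = sorted_list_of_set (lucky_spots N \<alpha> s) @ [N + 1]"
proof -
  have "{i \<in> {1..N}. rearrangement N \<alpha> ! (i - 1) = i} = lucky_spots N \<alpha> s"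
    using rearrangement_fixed_iff[OF assms] assms
    unfolding lucky_spots_def unit_spots_def by blast
  then show ?thesis by (simp add: cuts_def)
qed

section \<open>Blocks as intervals of spots\<close>

lemma length_phi: "length (phi N \<alpha>) = length (cuts N \<alpha>) - 1"
  by (simp add: phi_def)

text \<open>Spot and preference differ by at most one, so they could be separated by a cut only if
  an unlucky car parked exactly at that cut. Cuts up to \<open>N\<close> are held by lucky cars, and
  \<open>N + 1\<close> is not a spot.\<close>

lemma phi_nth:
  assumes us: "unit_spots N \<alpha> s" and j: "Suc j < length (cuts N \<alpha>)"
  shows "phi N \<alpha> ! j = {i \<in> {1..N}. s i \<in> {cuts N \<alpha> ! j..<cuts N \<alpha> ! Suc j}}"
proof -
  let ?c = "\<lambda>j. cuts N \<alpha> ! j"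
  have inj: "inj_on s {1..N}" and range: "\<And>i. i \<in> {1..N} \<Longrightarrow> s i \<in> {1..N}"
    and disp: "\<And>i. i \<in> {1..N} \<Longrightarrow> s i = \<alpha> i \<or> s i = Suc (\<alpha> i)"
    using us unfolding unit_spots_def by blast+
  have fin: "finite (lucky_spots N \<alpha> s)"
    by (rule finite_subset[of _ "s ` {1..N}"]) (unfold lucky_spots_def, blast, simp)
  have "set (cuts N \<alpha>) = insert (N + 1) (lucky_spots N \<alpha> s)"
    using cuts_eq[OF us] fin by simp
  then have mem: "?c k \<in> insert (N + 1) (lucky_spots N \<alpha> s)" if "k < length (cuts N \<alpha>)" for k
    using that nth_mem by blast
  have ne: "s i \<noteq> ?c k" if "i \<in> {1..N}" "s i = Suc (\<alpha> i)" "k < length (cuts N \<alpha>)" for i k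
  proof
    assume eq: "s i = ?c k"
    then have "s i \<in> lucky_spots N \<alpha> s"
      using mem[OF that(3)] range[OF that(1)] by auto
    then have "\<alpha> i = s i"
      unfolding lucky_spots_def using inj that(1) by (auto dest: inj_onD)
    then show False using that(2) by simp
  qed
  have "?c j \<le> \<alpha> i \<and> \<alpha> i < ?c (Suc j) \<longleftrightarrow> s i \<in> {?c j..<?c (Suc j)}" if "i \<in> {1..N}" for i
    using disp[OF that] ne[OF that, of j] ne[OF that, of "Suc j"] j by auto
  then show ?thesis
    using j unfolding phi_def by auto
qed

text \<open>An unlucky car finds the spot before its own already taken, so within a run of unlucky spots
  the cars arrive from left to right.\<close>

lemma spots_increasing:
  assumes us: "unit_spots N \<alpha> s"
  shows "k \<in> {1..N} \<Longrightarrow> k' \<in> {1..N} \<Longrightarrow> s k' = s k + Suc d \<Longrightarrow>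
     lucky_spots N \<alpha> s \<inter> {s k<..s k'} = {} \<Longrightarrow> k < k'"
proof -
  have inj: "inj_on s {1..N}"
    and disp: "\<And>i. i \<in> {1..N} \<Longrightarrow> s i = \<alpha> i \<or> (s i = Suc (\<alpha> i) \<and> (\<exists>j\<in>{1..<i}. s j = \<alpha> i))"
    using us unfolding unit_spots_def by blast+
  \<comment> \<open>The induction on the distance walks left from \<open>k'\<close>: each unlucky
    spot hands over to the spot just before it, held by an earlier car, until \<open>k\<close> is
    reached.\<close>
  have pred: "\<exists>j\<in>{1..<k'}. Suc (s j) = s k'"
    if "k' \<in> {1..N}" "s k < s k'" "lucky_spots N \<alpha> s \<inter> {s k<..s k'} = {}" for k'
  proof -
    have "s k' \<notin> lucky_spots N \<alpha> s" using that by auto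
    then have "s k' \<noteq> \<alpha> k'" using that(1) unfolding lucky_spots_def by auto
    then show ?thesis using disp[OF that(1)] by auto
  qed
  show "k \<in> {1..N} \<Longrightarrow> k' \<in> {1..N} \<Longrightarrow> s k' = s k + Suc d \<Longrightarrow>
     lucky_spots N \<alpha> s \<inter> {s k<..s k'} = {} \<Longrightarrow> k < k'"
  proof (induction d arbitrary: k')
    case 0
    then obtain j where j: "j \<in> {1..<k'}" "Suc (s j) = s k'" using pred[of k'] by auto
    then have "j = k" using 0 inj_onD[OF inj, of j k] by auto
    then show ?case using j by auto
  next
    case (Suc d)
    then obtain j where j: "j \<in> {1..<k'}" "Suc (s j) = s k'" using pred[of k'] by auto
    then have "lucky_spots N \<alpha> s \<inter> {s k<..s j} = {}" using Suc.prems(4) by fastforce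
    then have "k < j" using Suc.IH[of j] Suc.prems j by auto
    then show ?case using j by auto
  qed
qed

section \<open>From ordered set partitions to parking functions\<close>

lemma interval_index_exists:
  fixes c :: "nat \<Rightarrow> 'a::linorder"
  assumes "c 0 \<le> x" "x < c m"
  shows "\<exists>j<m. x \<in> {c j..<c (Suc j)}"
  using assms
proof (induction m)
  case (Suc m)
  then show ?case by (cases "x < c m") (auto intro: less_SucI)
qed simp

text \<open>For \<open>a < b\<close>, monotonicity gives \<open>c (Suc a) \<le> c b\<close>, so no
  point lies in both half-open intervals.\<close>

lemma interval_index_unique:
  fixes c :: "nat \<Rightarrow> 'a::linorder"
  assumes mono: "mono_on {..m} c" and "i < m" "j < m"
    and "x \<in> {c i..<c (Suc i)}" "x \<in> {c j..<c (Suc j)}"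
  shows "i = j"
proof -
  have "\<not> a < b" if "a < m" "b < m" "x \<in> {c a..<c (Suc a)}" "x \<in> {c b..<c (Suc b)}" for a b
    using mono_onD[OF mono, of "Suc a" b] that by (auto simp: Suc_le_eq)
  then show ?thesis using assms by (metis linorder_neqE_nat)
qed

text \<open>The first spot of a block when the blocks fill the street one after another;
  \<open>Suc\<close> appears because spots count from 1.\<close>

definition block_start :: "nat set list \<Rightarrow> nat \<Rightarrow> nat" where
  "block_start Cs j = Suc (\<Sum>t<j. card (Cs ! t))"

definition block_rank :: "nat set list \<Rightarrow> nat \<Rightarrow> nat \<Rightarrow> nat" where
  "block_rank Cs j i = card {k \<in> Cs ! j. k < i}"

text \<open>Meaningful only when the car lies in exactly one block, as it does in an ordered set
  partition.\<close>

definition block_index :: "nat set list \<Rightarrow> nat \<Rightarrow> nat" where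
  "block_index Cs i = (THE j. j < length Cs \<and> i \<in> Cs ! j)"

definition block_spot :: "nat set list \<Rightarrow> nat \<Rightarrow> nat" where
  "block_spot Cs i = block_start Cs (block_index Cs i) + block_rank Cs (block_index Cs i) i"

text \<open>The inverse of \<open>phi\<close>: the two earliest cars of a block both prefer its first spot, so the
  truncated subtraction is intended.\<close>

definition unphi :: "nat \<Rightarrow> nat set list \<Rightarrow> nat \<Rightarrow> nat" where
  "unphi N Cs = (\<lambda>i\<in>{1..N}. block_start Cs (block_index Cs i)
     + (block_rank Cs (block_index Cs i) i - 1))"

text \<open>Disjointness only identifies equal blocks; distinctness of the list then identifies
  their indices, which also makes the sizes add up to \<open>N\<close>.\<close>

lemma osp_D:
  assumes "ordered_set_partition N Cs"
  shows "\<And>j. j < length Cs \<Longrightarrow> finite (Cs ! j) \<and> Cs ! j \<noteq> {} \<and> Cs ! j \<subseteq> {1..N}"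
    and "\<And>i j j'. j < length Cs \<Longrightarrow> j' < length Cs \<Longrightarrow> i \<in> Cs ! j \<Longrightarrow> i \<in> Cs ! j' \<Longrightarrow> j = j'"
    and "\<And>i. i \<in> {1..N} \<Longrightarrow> \<exists>j<length Cs. i \<in> Cs ! j"
    and "(\<Sum>t<length Cs. card (Cs ! t)) = N"
proof -
  have d: "distinct Cs" and p: "partition_on {1..N} (set Cs)"
    using assms unfolding ordered_set_partition_def by auto
  show sub: "finite (Cs ! j) \<and> Cs ! j \<noteq> {} \<and> Cs ! j \<subseteq> {1..N}" if "j < length Cs" for j
  proof -
    have "Cs ! j \<in> set Cs" using that by simp
    then show ?thesis using p unfolding partition_on_def
      by (metis Union_upper finite_atLeastAtMost finite_subset)
  qed
  show uniq: "j = j'" if "j < length Cs" "j' < length Cs" "i \<in> Cs ! j" "i \<in> Cs ! j'" for i j j'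
  proof -
    have "Cs ! j = Cs ! j'"
      using p that unfolding partition_on_def disjoint_def by (metis IntI emptyE nth_mem)
    then show ?thesis using d that nth_eq_iff_index_eq by blast
  qed
  show cover: "\<exists>j<length Cs. i \<in> Cs ! j" if "i \<in> {1..N}" for i
    using p that unfolding partition_on_def by (metis UnionE in_set_conv_nth)
  have "(\<Sum>t<length Cs. card (Cs ! t)) = card (\<Union>t<length Cs. Cs ! t)"
    using sub uniq by (subst card_UN_disjoint) auto
  also have "(\<Union>t<length Cs. Cs ! t) = {1..N}"
    using sub cover by blast
  finally show "(\<Sum>t<length Cs. card (Cs ! t)) = N" by simp
qed

lemma block_index_eq:
  assumes "ordered_set_partition N Cs" "j < length Cs" "i \<in> Cs ! j"
  shows "block_index Cs i = j"
  unfolding block_index_def using osp_D(2)[OF assms(1)] assms(2,3) by blast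

lemma block_start_Suc: "block_start Cs (Suc j) = block_start Cs j + card (Cs ! j)"
  by (simp add: block_start_def)

lemma mono_block_start: "mono_on A (block_start Cs)"
  by (auto simp: block_start_def intro!: mono_onI sum_mono2)

lemma block_rank_less:
  assumes "finite (Cs ! j)" "i \<in> Cs ! j"
  shows "block_rank Cs j i < card (Cs ! j)"
  unfolding block_rank_def using assms by (intro psubset_card_mono) auto

lemma block_rank_strict_mono:
  assumes "finite (Cs ! j)" "i \<in> Cs ! j" "i < i'"
  shows "block_rank Cs j i < block_rank Cs j i'"
  unfolding block_rank_def using assms by (intro psubset_card_mono) auto

text \<open>The witness is the largest member of the block below \<open>i\<close>. In the parking
  process it is the car that holds the preferred spot of \<open>i\<close>.\<close>

lemma block_rank_pred:
  assumes fin: "finite (Cs ! j)" and "block_rank Cs j i \<noteq> 0"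
  obtains k where "k \<in> Cs ! j" "k < i" "block_rank Cs j i = Suc (block_rank Cs j k)"
proof -
  let ?S = "{k \<in> Cs ! j. k < i}"
  have "?S \<noteq> {}" using assms(2) unfolding block_rank_def by (metis card.empty)
  then have k: "Max ?S \<in> ?S" using fin by (intro Max_in) auto
  then obtain m where m: "m \<in> Cs ! j" "m < i" "m = Max ?S" by blast
  have "k \<le> m" if "k \<in> ?S" for k
    using Max_ge[of ?S k] that fin m(3) by simp
  then have "?S = insert m {k \<in> Cs ! j. k < m}"
    using m(1,2) by force
  then have "block_rank Cs j i = Suc (block_rank Cs j m)"
    unfolding block_rank_def using fin by simp
  then show thesis using m that by blast
qed

lemma block_rank_Min:
  assumes "finite (Cs ! j)" "Cs ! j \<noteq> {}"
  shows "block_rank Cs j (Min (Cs ! j)) = 0"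
  unfolding block_rank_def using assms by (auto simp: not_less)

text \<open>The blocks occupy consecutive disjoint intervals, and ranks separate the cars within
  one. A car of rank 0 is lucky; any other prefers the spot of its predecessor in the block. The
  explicit formulas are kept for computing with \<open>phi\<close> and \<open>unphi\<close>.\<close>

lemma unit_spots_unphi:
  assumes osp: "ordered_set_partition N Cs"
  shows "unit_spots N (unphi N Cs) (block_spot Cs)"
    and "\<And>i j. j < length Cs \<Longrightarrow> i \<in> Cs ! j \<Longrightarrow>
      block_spot Cs i = block_start Cs j + block_rank Cs j i"
    and "\<And>i j. j < length Cs \<Longrightarrow> i \<in> Cs ! j \<Longrightarrow>
      unphi N Cs i = block_start Cs j + (block_rank Cs j i - 1)"
    and "\<And>i j. j < length Cs \<Longrightarrow> i \<in> {1..N} \<Longrightarrow>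
      block_spot Cs i \<in> {block_start Cs j..<block_start Cs (Suc j)} \<longleftrightarrow> i \<in> Cs ! j"
proof -
  note D = osp_D[OF osp]
  show spot: "block_spot Cs i = block_start Cs j + block_rank Cs j i"
    if "j < length Cs" "i \<in> Cs ! j" for i j
    using block_index_eq[OF osp that] by (simp add: block_spot_def)
  show un: "unphi N Cs i = block_start Cs j + (block_rank Cs j i - 1)"
    if "j < length Cs" "i \<in> Cs ! j" for i j
    using block_index_eq[OF osp that] D(1)[OF that(1)] that by (auto simp: unphi_def)
  have ivl: "block_spot Cs i \<in> {block_start Cs j..<block_start Cs (Suc j)}"
    if "j < length Cs" "i \<in> Cs ! j" for i j
    using spot[OF that] block_rank_less[of Cs j i] D(1)[OF that(1)] that
    by (simp add: block_start_Suc)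
  show iff: "block_spot Cs i \<in> {block_start Cs j..<block_start Cs (Suc j)} \<longleftrightarrow> i \<in> Cs ! j"
    if j: "j < length Cs" and i: "i \<in> {1..N}" for i j
  proof
    assume *: "block_spot Cs i \<in> {block_start Cs j..<block_start Cs (Suc j)}"
    obtain j' where j': "j' < length Cs" "i \<in> Cs ! j'" using D(3)[OF i] by blast
    then have "j' = j"
      using interval_index_unique[OF mono_block_start _ _ ivl[OF j'] *] j by blast
    then show "i \<in> Cs ! j" using j' by simp
  qed (use ivl j in blast)
  have "inj_on (block_spot Cs) {1..N}"
  proof (rule inj_onI)
    fix i i' assume *: "i \<in> {1..N}" "i' \<in> {1..N}" "block_spot Cs i = block_spot Cs i'"
    obtain j where j: "j < length Cs" "i \<in> Cs ! j" using D(3)[OF *(1)] by blast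
    have j': "i' \<in> Cs ! j"
      using ivl[OF j] iff[OF j(1) *(2)] *(3) by simp
    have "block_rank Cs j i = block_rank Cs j i'"
      using spot[OF j] spot[OF j(1) j'] *(3) by simp
    then show "i = i'"
      using block_rank_strict_mono[of Cs j] D(1)[OF j(1)] j j' by (metis less_irrefl linorder_neqE_nat)
  qed
  moreover have "block_spot Cs i \<in> {1..N}" if i: "i \<in> {1..N}" for i
  proof -
    obtain j where j: "j < length Cs" "i \<in> Cs ! j" using D(3)[OF i] by blast
    \<comment> \<open>The last interval ends just before \<open>N + 1\<close>, because the block
      sizes sum to \<open>N\<close>.\<close>
    have "block_start Cs (Suc j) \<le> block_start Cs (length Cs)"
      using mono_onD[OF mono_block_start[of UNIV Cs], of "Suc j" "length Cs"] j by simp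
    also have "\<dots> = Suc N" using D(4) by (simp add: block_start_def)
    finally show ?thesis using ivl[OF j] by (auto simp: block_start_def)
  qed
  moreover have "block_spot Cs i = unphi N Cs i \<or> (block_spot Cs i = Suc (unphi N Cs i)
      \<and> (\<exists>k\<in>{1..<i}. block_spot Cs k = unphi N Cs i))" if i: "i \<in> {1..N}" for i
  proof -
    obtain j where j: "j < length Cs" "i \<in> Cs ! j" using D(3)[OF i] by blast
    show ?thesis
    proof (cases "block_rank Cs j i = 0")
      case True
      then show ?thesis using spot[OF j] un[OF j] by simp
    next
      case False
      then obtain k where k: "k \<in> Cs ! j" "k < i" "block_rank Cs j i = Suc (block_rank Cs j k)"
        using block_rank_pred D(1)[OF j(1)] by metis
      then have "k \<in> {1..<i}" using D(1)[OF j(1)] by fastforce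
      then show ?thesis using k spot[OF j] un[OF j] spot[OF j(1) k(1)] by auto
    qed
  qed
  ultimately show "unit_spots N (unphi N Cs) (block_spot Cs)"
    unfolding unit_spots_def by blast
qed

lemma unphi_in_UPF:
  assumes "ordered_set_partition N Cs"
  shows "unphi N Cs \<in> UPF N"
  using UPF_of_unit_spots[OF unit_spots_unphi(1)[OF assms]] by (simp add: unphi_def)

text \<open>The lucky cars are the block minima, so the cuts are the block starts and the intervals
  between them return the blocks.\<close>

lemma phi_unphi:
  assumes osp: "ordered_set_partition N Cs"
  shows "phi N (unphi N Cs) = Cs"
proof -
  note D = osp_D[OF osp] and U = unit_spots_unphi[OF osp]
  let ?c = "block_start Cs" and ?m = "length Cs"
  have "lucky_spots N (unphi N Cs) (block_spot Cs) = ?c ` {..<?m}"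
  proof (intro equalityI subsetI)
    fix x assume "x \<in> lucky_spots N (unphi N Cs) (block_spot Cs)"
    then obtain i where i: "i \<in> {1..N}" "block_spot Cs i = x" "unphi N Cs i = x"
      unfolding lucky_spots_def by blast
    obtain j where j: "j < ?m" "i \<in> Cs ! j" using D(3)[OF i(1)] by blast
    \<comment> \<open>Spot and preference agree, so the rank equals its truncated predecessor, which
      happens only at 0.\<close>
    have "block_rank Cs j i = 0" using U(2,3)[OF j] i by simp
    then show "x \<in> ?c ` {..<?m}" using U(2)[OF j] i j by auto
  next
    fix x assume "x \<in> ?c ` {..<?m}"
    then obtain j where j: "j < ?m" "x = ?c j" by blast
    let ?k = "Min (Cs ! j)"
    have k: "?k \<in> Cs ! j" "block_rank Cs j ?k = 0"
      using D(1)[OF j(1)] block_rank_Min by auto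
    then have "block_spot Cs ?k = x" "unphi N Cs ?k = x"
      using U(2,3)[OF j(1) k(1)] j by auto
    moreover have "?k \<in> {1..N}" using D(1)[OF j(1)] k(1) by blast
    ultimately show "x \<in> lucky_spots N (unphi N Cs) (block_spot Cs)"
      unfolding lucky_spots_def by blast
  qed
  also have "\<dots> = set (map ?c [0..<?m])" by auto
  finally have L: "lucky_spots N (unphi N Cs) (block_spot Cs) = set (map ?c [0..<?m])" .
  \<comment> \<open>Nonempty blocks make the starts strictly increasing, so sorting the set of
    starts returns them in block order.\<close>
  have smono: "?c i < ?c j" if "i < j" "j < ?m" for i j
  proof -
    have "?c i < ?c (Suc i)" using D(1)[of i] that by (auto simp: block_start_Suc card_gt_0_iff)
    also have "\<dots> \<le> ?c j" using mono_onD[OF mono_block_start[of UNIV Cs]] that by simp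
    finally show ?thesis .
  qed
  then have "sorted_wrt (<) (map ?c [0..<?m])"
    by (simp add: sorted_wrt_iff_nth_less)
  then have "sorted_list_of_set (set (map ?c [0..<?m])) = map ?c [0..<?m]"
    by (metis sorted_list_of_set.idem_if_sorted_distinct strict_sorted_iff)
  then have "cuts N (unphi N Cs) = map ?c [0..<?m] @ [N + 1]"
    using cuts_eq[OF U(1)] L by simp
  \<comment> \<open>The final cut \<open>N + 1\<close> is the start that would follow the last
    block.\<close>
  also have "\<dots> = map ?c [0..<Suc ?m]" using D(4) by (simp add: block_start_def)
  finally have cuts: "cuts N (unphi N Cs) = map ?c [0..<Suc ?m]" .
  show ?thesis
  proof (rule nth_equalityI)
    show len: "length (phi N (unphi N Cs)) = ?m" by (simp add: length_phi cuts)
    fix j assume "j < length (phi N (unphi N Cs))"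
    then have j: "j < ?m" using len by simp
    have "phi N (unphi N Cs) ! j = {i \<in> {1..N}. block_spot Cs i \<in> {?c j..<?c (Suc j)}}"
      using phi_nth[OF U(1), of j] j by (simp add: cuts del: upt_Suc)
    also have "\<dots> = {i \<in> {1..N}. i \<in> Cs ! j}" using U(4)[OF j] by blast
    also have "\<dots> = Cs ! j" using D(1)[OF j] by blast
    finally show "phi N (unphi N Cs) ! j = Cs ! j" .
  qed
qed

section \<open>Recovering a parking function from its blocks\<close>

text \<open>Within a block the spots increase with the car labels, so the spot is the left end of
  the block plus the rank. The preference is that spot for rank 0 and one less otherwise, which is
  what \<open>unphi\<close> computes.\<close>

lemma phi_osp_unphi:
  assumes "\<alpha> \<in> UPF N"
  shows "ordered_set_partition N (phi N \<alpha>)" "unphi N (phi N \<alpha>) = \<alpha>"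
proof -
  define s where "s = (\<lambda>i. the (park N \<alpha> i))"
  have us: "unit_spots N \<alpha> s" unfolding s_def by (rule unit_spots_of_UPF[OF assms])
  let ?L = "lucky_spots N \<alpha> s" and ?Cs = "phi N \<alpha>" and ?m = "length (phi N \<alpha>)"
  define c where "c = (\<lambda>j. cuts N \<alpha> ! j)"
  have inj: "inj_on s {1..N}" and range: "\<And>i. i \<in> {1..N} \<Longrightarrow> s i \<in> {1..N}"
    and disp: "\<And>i. i \<in> {1..N} \<Longrightarrow> s i = \<alpha> i \<or> (s i = Suc (\<alpha> i) \<and> (\<exists>j\<in>{1..<i}. s j = \<alpha> i))"
    using us unfolding unit_spots_def by blast+
  have Lsub: "?L \<subseteq> {1..N}" using range unfolding lucky_spots_def by blast
  then have fin: "finite ?L" using finite_subset by blast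
  have lenc: "length (cuts N \<alpha>) = Suc ?m" by (simp add: length_phi cuts_eq[OF us])
  have m: "?m = card ?L" by (simp add: length_phi cuts_eq[OF us])
  have "sorted_wrt (<) (cuts N \<alpha>)"
    using Lsub fin by (auto simp: cuts_eq[OF us] sorted_wrt_append)
  then have smono: "c i < c j" if "i < j" "j \<le> ?m" for i j
    using that lenc unfolding c_def by (simp add: sorted_wrt_iff_nth_less)
  then have mono: "mono_on {..?m} c"
    by (intro mono_onI) (metis atMost_iff le_less order_refl)
  have cm: "c ?m = Suc N" by (simp add: c_def cuts_eq[OF us] m nth_append)
  have "c ` {..<?m} = (!) (sorted_list_of_set ?L) ` {..<length (sorted_list_of_set ?L)}"
    using m by (intro image_cong) (auto simp: c_def cuts_eq[OF us] nth_append)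
  also have "\<dots> = ?L"
    using fin nth_image[of "length (sorted_list_of_set ?L)" "sorted_list_of_set ?L"]
    by (simp add: lessThan_atLeast0)
  finally have Lc: "?L = c ` {..<?m}" ..
  \<comment> \<open>The car at spot 1 is lucky, since an unlucky one would need a car at spot 0. For
    \<open>N = 0\<close> the only cut is the final entry \<open>N + 1\<close>.\<close>
  have c0: "c 0 = 1"
  proof (cases "N = 0")
    case True
    then have "?L = {}" using Lsub by auto
    then show ?thesis using cm m True by simp
  next
    case False
    then obtain k where k: "k \<in> {1..N}" "s k = 1"
      using unit_spots_bij[OF us] unfolding bij_betw_def by (metis atLeastAtMost_iff imageE le_refl less_one not_le)
    have "\<alpha> k = 1"
    proof (rule ccontr)
      assume "\<alpha> k \<noteq> 1"
      then obtain j where "j \<in> {1..<k}" "s j = 0" using disp[OF k(1)] k(2) by auto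
      then show False using range[of j] k by auto
    qed
    then have "1 \<in> ?L" using k unfolding lucky_spots_def by blast
    then obtain j where j: "j < ?m" "c j = 1" using Lc by auto
    have "c 0 \<in> ?L" using Lc j by auto
    then have "c 0 \<ge> 1" using Lsub by auto
    moreover have "c 0 \<le> c j" using mono_onD[OF mono, of 0 j] j by auto
    ultimately show ?thesis using j by simp
  qed
  have blk: "?Cs ! j = {i \<in> {1..N}. s i \<in> {c j..<c (Suc j)}}" if "j < ?m" for j
    using phi_nth[OF us, of j] that lenc unfolding c_def by simp
  have cN: "c j \<in> {1..Suc N}" if "j \<le> ?m" for j
    using mono_onD[OF mono, of 0 j] mono_onD[OF mono, of j ?m] c0 cm that by auto
  have cardb: "card (?Cs ! j) = c (Suc j) - c j" if "j < ?m" for j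
  proof -
    have "{c j..<c (Suc j)} \<subseteq> {1..N}" using cN[of j] cN[of "Suc j"] that by auto
    from card_cars_in_spots[OF us this] show ?thesis using blk[OF that] by simp
  qed
  \<comment> \<open>Block sizes are differences of consecutive cuts, so their partial sums
    telescope.\<close>
  have start: "block_start ?Cs j = c j" if "j \<le> ?m" for j
    using that
  proof (induction j)
    case 0
    then show ?case using c0 by (simp add: block_start_def)
  next
    case (Suc j)
    then show ?case using cardb[of j] smono[of j "Suc j"] by (simp add: block_start_Suc)
  qed
  have cover: "\<exists>j<?m. i \<in> ?Cs ! j" if "i \<in> {1..N}" for i
    using interval_index_exists[of c "s i" ?m] c0 cm range[OF that] that blk by auto
  have uniq: "j = j'" if "j < ?m" "j' < ?m" "i \<in> ?Cs ! j" "i \<in> ?Cs ! j'" for i j j'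
    using interval_index_unique[OF mono that(1,2), of "s i"] that blk by auto
  have ne: "?Cs ! j \<noteq> {}" if "j < ?m" for j
    using cardb[OF that] smono[of j "Suc j"] that by (metis Suc_leI card.empty lessI zero_less_diff less_irrefl)
  show osp: "ordered_set_partition N ?Cs"
    unfolding ordered_set_partition_def
  proof
    show "distinct ?Cs"
      unfolding distinct_conv_nth using uniq ne by (metis ex_in_conv)
    show "partition_on {1..N} (set ?Cs)"
    proof (rule partition_onI)
      show "\<Union> (set ?Cs) = {1..N}"
      proof
        show "\<Union> (set ?Cs) \<subseteq> {1..N}" using blk by (auto simp: in_set_conv_nth)
        show "{1..N} \<subseteq> \<Union> (set ?Cs)" using cover nth_mem by blast
      qed
      show "disjnt p q" if "p \<in> set ?Cs" "q \<in> set ?Cs" "p \<noteq> q" for p q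
        using that uniq unfolding disjnt_iff in_set_conv_nth by metis
      show "{} \<notin> set ?Cs"
        using ne unfolding in_set_conv_nth by metis
    qed
  qed
  show "unphi N ?Cs = \<alpha>"
  proof (rule extensionalityI[of _ "{1..N}"])
    show "unphi N ?Cs \<in> extensional {1..N}" by (simp add: unphi_def)
    show "\<alpha> \<in> extensional {1..N}"
      using assms unfolding UPF_def parking_functions_def tuples_def PiE_def by blast
    fix i assume i: "i \<in> {1..N}"
    obtain j where j: "j < ?m" "i \<in> ?Cs ! j" using cover[OF i] by blast
    let ?R = "{k \<in> ?Cs ! j. k < i}"
    have blkD: "a \<in> {1..N}" "c j \<le> s a" "s a < c (Suc j)" if "a \<in> ?Cs ! j" for a
      using that unfolding blk[OF j(1)] by simp_all
    have inc: "a < b" if a: "a \<in> ?Cs ! j" and b: "b \<in> ?Cs ! j" and ab: "s a < s b" for a b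
    proof (rule spots_increasing[OF us blkD(1)[OF a] blkD(1)[OF b]])
      show "s b = s a + Suc (s b - s a - 1)" using ab by simp
      \<comment> \<open>Cuts with index at most \<open>j\<close> lie at or left of
        \<open>s a\<close>, and later ones lie right of \<open>s b\<close>; hence every spot after
        \<open>s a\<close> up to \<open>s b\<close> is unlucky.\<close>
      have "\<not> (s a < c k \<and> c k \<le> s b)" if k: "k < ?m" for k
      proof (cases "k \<le> j")
        case True
        then have "c k \<le> c j" using mono_onD[OF mono, of k j] j(1) by simp
        then show ?thesis using blkD(2)[OF a] by simp
      next
        case False
        then have "c (Suc j) \<le> c k" using mono_onD[OF mono, of "Suc j" k] k by simp
        then show ?thesis using blkD(3)[OF b] by simp
      qed
      then show "?L \<inter> {s a<..s b} = {}" unfolding Lc by auto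
    qed
    have less_iff: "k < i \<longleftrightarrow> s k < s i" if k: "k \<in> ?Cs ! j" for k
    proof -
      have "s k = s i \<longleftrightarrow> k = i" by (rule inj_on_eq_iff[OF inj blkD(1)[OF k] i])
      then show ?thesis using inc[OF k j(2)] inc[OF j(2) k] by (metis less_asym linorder_neqE_nat)
    qed
    \<comment> \<open>The rank of \<open>i\<close> thus counts the spots from the left end of the
      block up to, but excluding, \<open>s i\<close>.\<close>
    have "?R = {k \<in> ?Cs ! j. s k < s i}"
      using less_iff by blast
    also have "\<dots> = {k \<in> {1..N}. s k \<in> {c j..<s i}}"
      using blkD(3)[OF j(2)] unfolding blk[OF j(1)] by auto
    finally have "?R = {k \<in> {1..N}. s k \<in> {c j..<s i}}" .
    moreover have "{c j..<s i} \<subseteq> {1..N}"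
      using cN[of j] range[OF i] j(1) by auto
    ultimately have "card ?R = s i - c j"
      using card_cars_in_spots[OF us, of "{c j..<s i}"] by simp
    moreover have "c j \<le> s i" using j blk[OF j(1)] by auto
    ultimately have si: "s i = c j + block_rank ?Cs j i" by (simp add: block_rank_def)
    have un: "unphi N ?Cs i = c j + (block_rank ?Cs j i - 1)"
      using unit_spots_unphi(3)[OF osp j] start[of j] j by simp
    \<comment> \<open>Each lucky spot is the left end of some block, and inside block
      \<open>j\<close> only \<open>c j\<close> qualifies.\<close>
    have "s i \<in> ?L \<longleftrightarrow> block_rank ?Cs j i = 0"
    proof
      assume "s i \<in> ?L"
      then obtain k where k: "k < ?m" "s i = c k" unfolding Lc by auto
      then have "s i \<in> {c k..<c (Suc k)}" using smono[of k "Suc k"] by auto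
      then have "k = j" using interval_index_unique[OF mono k(1) j(1)] j blk[OF j(1)] by auto
      then show "block_rank ?Cs j i = 0" using k si by simp
    qed (use si Lc j in auto)
    moreover have "s i \<in> ?L \<longleftrightarrow> s i = \<alpha> i"
      using inj i unfolding lucky_spots_def by (auto dest: inj_onD)
    ultimately show "unphi N ?Cs i = \<alpha> i"
      using un si disp[OF i] by auto
  qed
qed

lemma bij_betw_phi: "bij_betw (phi N) (UPF N) {Cs. ordered_set_partition N Cs}"
  by (rule bij_betw_byWitness[where f' = "unphi N"])
     (use phi_osp_unphi phi_unphi unphi_in_UPF in auto)

section \<open>Distinct first entries and separated blocks\<close>

text \<open>Kept identical to the side condition in \<open>r_stirling\<close>, so that the two match
  by unfolding.\<close>

definition separated :: "nat \<Rightarrow> nat set set \<Rightarrow> bool" where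
  "separated r P \<longleftrightarrow> (\<forall>i\<in>{1..r}. \<forall>j\<in>{1..r}. i \<noteq> j \<longrightarrow> \<not> (\<exists>B\<in>P. i \<in> B \<and> j \<in> B))"

text \<open>If two of the cars \<open>1, ..., r\<close> share a block, its two smallest cars are
  also at most \<open>r\<close> and prefer the same spot. Conversely, the preferences of a block
  stay in its own interval, so equal preferences force a common block.\<close>

lemma inj_on_iff_separated:
  assumes "\<alpha> \<in> UPF N" "r \<le> N"
  shows "inj_on \<alpha> {1..r} \<longleftrightarrow> separated r (set (phi N \<alpha>))"
proof
  note osp = phi_osp_unphi(1)[OF assms(1)] and eq = phi_osp_unphi(2)[OF assms(1)]
  note D = osp_D[OF osp] and U = unit_spots_unphi(3)[OF osp, unfolded eq]
  let ?Cs = "phi N \<alpha>"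
  {
    assume inj: "inj_on \<alpha> {1..r}"
    have False if ij: "i \<in> {1..r}" "j \<in> {1..r}" "i < j" "i \<in> ?Cs ! b" "j \<in> ?Cs ! b"
      and b: "b < length ?Cs" for i j b
    proof -
      let ?B = "?Cs ! b"
      \<comment> \<open>The two smallest cars of the block. Since \<open>?k \<le> i < j\<close>,
        removing \<open>?k\<close> leaves \<open>j\<close>, whence \<open>?l \<le> j\<close>; their
        ranks 0 and 1 have the same truncated predecessor.\<close>
      let ?k = "Min ?B" let ?l = "Min (?B - {?k})"
      have fin: "finite ?B" and sub: "?B \<subseteq> {1..N}" using D(1)[OF b] by auto
      have k: "?k \<in> ?B" "?k \<le> i" using Min_in[OF fin] Min_le[OF fin] ij by blast+
      have "j \<in> ?B - {?k}" using ij k by auto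
      then have l: "?l \<in> ?B - {?k}" "?l \<le> j"
        using fin by (metis Min_in empty_iff finite_Diff, simp add: Min_le)
      have "x = ?k" if "x \<in> ?B" "x < ?l" for x
        using Min_le[of "?B - {?k}" x] that fin by (metis DiffI finite_Diff not_le singletonD)
      moreover have "?k < ?l" using l(1) Min_le[OF fin, of ?l] by (metis DiffE le_neq_implies_less singletonI)
      ultimately have "{x \<in> ?B. x < ?l} = {?k}" using k by blast
      then have "block_rank ?Cs b ?l = 1" by (simp add: block_rank_def)
      moreover have "block_rank ?Cs b ?k = 0" using block_rank_Min fin ij by blast
      ultimately have "\<alpha> ?k = \<alpha> ?l" using U[OF b, of ?k] U[OF b, of ?l] k l by simp
      moreover have "?k \<in> {1..r}" "?l \<in> {1..r}" using k l sub ij by fastforce+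
      ultimately show False using inj l by (metis DiffD2 inj_onD singletonI)
    qed
    then have "\<not> (i \<in> ?Cs ! b \<and> j \<in> ?Cs ! b)"
      if "i \<in> {1..r}" "j \<in> {1..r}" "i \<noteq> j" "b < length ?Cs" for i j b
      using that by (meson linorder_neqE_nat)
    then show "separated r (set ?Cs)"
      unfolding separated_def Bex_def in_set_conv_nth by blast
  }
  {
    assume sep: "separated r (set ?Cs)"
    show "inj_on \<alpha> {1..r}"
    proof (rule inj_onI, rule ccontr)
      fix i i' assume *: "i \<in> {1..r}" "i' \<in> {1..r}" "\<alpha> i = \<alpha> i'" "i \<noteq> i'"
      have "\<exists>b<length ?Cs. x \<in> ?Cs ! b \<and> \<alpha> x \<in> {block_start ?Cs b..<block_start ?Cs (Suc b)}"
        if "x \<in> {1..r}" for x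
      proof -
        have "x \<in> {1..N}" using that assms(2) by auto
        then obtain b where b: "b < length ?Cs" "x \<in> ?Cs ! b" using D(3) by blast
        then show ?thesis
          using U[OF b] block_rank_less[of ?Cs b x] D(1)[OF b(1)]
          by (intro exI[of _ b]) (auto simp: block_start_Suc)
      qed
      from this[OF *(1)] this[OF *(2)] obtain b b' where
        b: "b < length ?Cs" "i \<in> ?Cs ! b" "\<alpha> i \<in> {block_start ?Cs b..<block_start ?Cs (Suc b)}" and
        b': "b' < length ?Cs" "i' \<in> ?Cs ! b'" "\<alpha> i' \<in> {block_start ?Cs b'..<block_start ?Cs (Suc b')}"
        by blast
      have "b = b'"
        using interval_index_unique[OF mono_block_start b(1) b'(1) b(3)] b'(3) *(3) by simp
      then show False using sep * b b' nth_mem unfolding separated_def by metis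
    qed
  }
qed

section \<open>Deranged orderings of a set partition\<close>

lemma nth_pred_eq_iff:
  assumes "distinct xs" "i \<in> {1..length xs}" "j \<in> {1..length xs}"
  shows "xs ! (i - 1) = xs ! (j - 1) \<longleftrightarrow> i = j"
  using assms by (cases i; cases j) (auto simp: nth_eq_iff_index_eq)

lemma card_deranged_lists:
  assumes "distinct B"
  shows "card {Cs. distinct Cs \<and> set Cs = set B \<and> (\<forall>i<length Cs. Cs ! i \<noteq> B ! i)}
    = derangement_number (length B)" (is "card ?X = _")
proof -
  let ?K = "length B"
  let ?D = "{p. p permutes {1..?K} \<and> (\<forall>i\<in>{1..?K}. p i \<noteq> i)}"
  \<comment> \<open>A derangement \<open>p\<close> lists the entries of \<open>B\<close> in the
    order \<open>p 1, p 2, ...\<close>; a fixed point of \<open>p\<close> would be an agreement with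
    \<open>B\<close>. \<open>Suc\<close> and \<open>- 1\<close> translate between
    \<open>{1..?K}\<close> and list positions.\<close>
  define f where "f = (\<lambda>p. map (\<lambda>i. B ! (p (Suc i) - 1)) [0..<?K])"
  have inj: "inj_on f ?D"
  proof (rule inj_onI)
    fix p q assume p: "p \<in> ?D" and q: "q \<in> ?D" and eq: "f p = f q"
    have "p x = q x" for x
    proof (cases "x \<in> {1..?K}")
      case True
      have mem: "p x \<in> {1..?K}" "q x \<in> {1..?K}"
        using p q permutes_in_image[of _ "{1..?K}" x] True by blast+
      have "f p ! (x - 1) = f q ! (x - 1)" using eq by simp
      then have "B ! (p x - 1) = B ! (q x - 1)" using True by (auto simp: f_def)
      then show ?thesis using nth_pred_eq_iff[OF assms] mem by blast
    next
      case False
      then show ?thesis using p q permutes_not_in by (metis (no_types, lifting) mem_Collect_eq)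
    qed
    then show "p = q" by blast
  qed
  have sub: "f p \<in> ?X" if p: "p \<in> ?D" for p
  proof -
    have mem: "p (Suc i) \<in> {1..?K}" if "i < ?K" for i
      using p permutes_in_image[of p "{1..?K}" "Suc i"] that by auto
    have d: "distinct (f p)"
      unfolding distinct_conv_nth
    proof (intro allI impI)
      fix i j assume ij: "i < length (f p)" "j < length (f p)" "i \<noteq> j"
      then have "p (Suc i) \<noteq> p (Suc j)"
        using p permutes_inj[of p] by (auto dest: injD)
      then show "f p ! i \<noteq> f p ! j"
        using mem[of i] mem[of j] ij nth_pred_eq_iff[OF assms] by (simp add: f_def)
    qed
    have "B ! (p (Suc i) - 1) \<in> set B" if "i < ?K" for i
      using mem[OF that] by (intro nth_mem) auto
    then have "set (f p) \<subseteq> set B" by (auto simp: f_def)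
    moreover have "card (set (f p)) = card (set B)"
      using distinct_card[OF d] distinct_card[OF assms] by (simp add: f_def)
    ultimately have "set (f p) = set B" by (simp add: card_subset_eq)
    moreover have "f p ! i \<noteq> B ! i" if "i < ?K" for i
    proof -
      have "p (Suc i) \<noteq> Suc i" using p that by auto
      then show ?thesis
        using mem[OF that] that nth_pred_eq_iff[OF assms, of "p (Suc i)" "Suc i"]
        by (simp add: f_def)
    qed
    ultimately show ?thesis using d by (simp add: f_def)
  qed
  have surj: "Cs \<in> f ` ?D" if "Cs \<in> ?X" for Cs
  proof -
    have Cs: "distinct Cs" "set Cs = set B" "\<And>i. i < length Cs \<Longrightarrow> Cs ! i \<noteq> B ! i"
      using that by simp_all
    have len: "length Cs = ?K"
      using distinct_card[OF Cs(1)] distinct_card[OF assms] Cs(2) by simp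
    have "\<forall>i\<in>{1..?K}. \<exists>k\<in>{1..?K}. B ! (k - 1) = Cs ! (i - 1)"
    proof
      fix i assume "i \<in> {1..?K}"
      then have "i - 1 < length Cs" unfolding len atLeastAtMost_iff by arith
      then have "Cs ! (i - 1) \<in> set B" unfolding Cs(2)[symmetric] by (rule nth_mem)
      then obtain k where "k < ?K" "B ! k = Cs ! (i - 1)" unfolding in_set_conv_nth by blast
      then show "\<exists>k\<in>{1..?K}. B ! (k - 1) = Cs ! (i - 1)" by (intro bexI[of _ "Suc k"]) auto
    qed
    then have "\<exists>g. \<forall>i\<in>{1..?K}. g i \<in> {1..?K} \<and> B ! (g i - 1) = Cs ! (i - 1)"
      by (intro bchoice) blast
    then obtain g where g: "\<And>i. i \<in> {1..?K} \<Longrightarrow> g i \<in> {1..?K} \<and> B ! (g i - 1) = Cs ! (i - 1)"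
      by blast
    \<comment> \<open>\<open>g\<close> sends a position in \<open>Cs\<close> to the position of the
      same entry in \<open>B\<close>; the identity outside \<open>{1..?K}\<close> is what
      \<open>permutes\<close> demands.\<close>
    define p where "p = (\<lambda>i. if i \<in> {1..?K} then g i else i)"
    have "inj_on p {1..?K}"
    proof (rule inj_onI)
      fix i j assume ij: "i \<in> {1..?K}" "j \<in> {1..?K}" "p i = p j"
      then have "Cs ! (i - 1) = Cs ! (j - 1)" using g[of i] g[of j] by (simp add: p_def)
      then show "i = j" using nth_pred_eq_iff[OF Cs(1)] ij len by simp
    qed
    moreover have "p ` {1..?K} \<subseteq> {1..?K}" using g by (auto simp: p_def)
    ultimately have "bij_betw p {1..?K} {1..?K}"
      by (simp add: bij_betw_def endo_inj_surj)
    then have "p permutes {1..?K}" by (rule bij_imp_permutes) (auto simp: p_def)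
    moreover have "\<forall>i\<in>{1..?K}. p i \<noteq> i"
    proof (intro ballI notI)
      fix i assume that: "i \<in> {1..?K}"
      assume "p i = i"
      then have "B ! (i - 1) = Cs ! (i - 1)" using g[OF that] that by (simp add: p_def)
      moreover have "i - 1 < length Cs" using that unfolding len atLeastAtMost_iff by arith
      ultimately show False using Cs(3) by metis
    qed
    ultimately have "p \<in> ?D" by (intro CollectI conjI)
    moreover have "Cs = f p"
    proof (rule nth_equalityI)
      fix i assume "i < length Cs"
      then show "Cs ! i = f p ! i" using g[of "Suc i"] len by (simp add: f_def p_def)
    qed (simp add: f_def len)
    ultimately show ?thesis by (intro image_eqI)
  qed
  have "f ` ?D = ?X"
    by (intro equalityI image_subsetI subsetI sub surj)
  then have "card ?X = card ?D" using card_image[OF inj] by simp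
  then show ?thesis by (simp only: derangement_number_def)
qed

text \<open>Disjoint nonempty blocks have different minima, so sorting by \<open>Min\<close> gives
  the same list \<open>B\<close> for every ordering. Being deranged thus means differing from
  \<open>B\<close> at every position.\<close>

lemma card_deranged_orderings:
  assumes P: "partition_on {1..N} P"
  shows "card {Cs. set Cs = P \<and> deranged N Cs} = derangement_number (card P)"
proof -
  have finP: "finite P" using P finite_elements by blast
  then obtain xs where xs: "set xs = P" "distinct xs" using finite_distinct_list by blast
  define B where "B = sort_key Min xs"
  have B: "set B = P" "distinct B" using xs by (simp_all add: B_def)
  have "inj_on Min P"
  proof (rule inj_onI)
    fix b c assume *: "b \<in> P" "c \<in> P" "Min b = Min c"
    have "finite b" "finite c" "b \<noteq> {}" "c \<noteq> {}"
      using P * unfolding partition_on_def by (metis Union_upper finite_atLeastAtMost finite_subset)+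
    then have "Min b \<in> b \<inter> c" using * Min_in by (metis IntI)
    then show "b = c" using P * unfolding partition_on_def disjoint_def by blast
  qed
  then have "sort_key Min Cs = B" if "distinct Cs" "set Cs = P" for Cs
    using that B xs by (intro sort_key_inj_key_eq) (auto simp: B_def set_eq_iff_mset_eq_distinct)
  then have "{Cs. set Cs = P \<and> deranged N Cs}
      = {Cs. distinct Cs \<and> set Cs = set B \<and> (\<forall>i<length Cs. Cs ! i \<noteq> B ! i)}"
    using P B unfolding deranged_def ordered_set_partition_def by auto
  then show ?thesis
    using card_deranged_lists[OF B(2)] B by (metis distinct_card)
qed

section \<open>Summing over set partitions\<close>

text \<open>\<open>phi\<close> carries the functions to ordered set partitions, which are grouped by
  their underlying set of blocks. The groups are disjoint because a list determines its set.\<close>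

lemma card_DUPF:
  assumes "r \<le> N"
  shows "card (DUPF r N) = (\<Sum>P | partition_on {1..N} P \<and> separated r P. derangement_number (card P))"
proof -
  let ?P = "{P. partition_on {1..N} P \<and> separated r P}"
  let ?X = "\<lambda>P. {Cs. set Cs = P \<and> deranged N Cs}"
  have finP: "finite ?P"
    by (rule finite_subset[OF _ finitely_many_partition_on[of "{1..N}"]]) auto
  have fin: "finite (?X P)" if "P \<in> ?P" for P
  proof (rule finite_subset)
    show "?X P \<subseteq> {Cs. set Cs \<subseteq> P \<and> length Cs \<le> card P}"
      unfolding deranged_def ordered_set_partition_def by (auto simp: distinct_card)
    show "finite {Cs. set Cs \<subseteq> P \<and> length Cs \<le> card P}"
      using that finite_elements[of "{1..N}" P] by (intro finite_lists_length_le) auto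
  qed
  have "bij_betw (phi N) (DUPF r N) (\<Union>P\<in>?P. ?X P)"
  proof (rule bij_betw_subset[OF bij_betw_phi])
    show "DUPF r N \<subseteq> UPF N" unfolding DUPF_def by blast
    have "DUPF r N = {\<alpha> \<in> UPF N. separated r (set (phi N \<alpha>)) \<and> deranged N (phi N \<alpha>)}"
      unfolding DUPF_def using inj_on_iff_separated[OF _ assms] by (intro Collect_cong) metis
    also have "phi N ` \<dots> = {Cs \<in> phi N ` UPF N. separated r (set Cs) \<and> deranged N Cs}"
      by blast
    also have "\<dots> = {Cs. ordered_set_partition N Cs \<and> separated r (set Cs) \<and> deranged N Cs}"
      using bij_betw_imp_surj_on[OF bij_betw_phi[of N]] by simp
    also have "\<dots> = (\<Union>P\<in>?P. ?X P)"
      unfolding deranged_def ordered_set_partition_def by auto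
    finally show "phi N ` DUPF r N = (\<Union>P\<in>?P. ?X P)" .
  qed
  then have "card (DUPF r N) = card (\<Union>P\<in>?P. ?X P)" by (rule bij_betw_same_card)
  also have "\<dots> = (\<Sum>P\<in>?P. card (?X P))"
    using finP fin by (intro card_UN_disjoint) auto
  also have "\<dots> = (\<Sum>P\<in>?P. derangement_number (card P))"
    by (intro sum.cong) (auto intro: card_deranged_orderings)
  finally show ?thesis .
qed

lemma card_partition_on_le:
  assumes "partition_on A P" "finite A"
  shows "card P \<le> card A"
proof -
  have "card P = (\<Sum>b\<in>P. 1)" by simp
  also have "\<dots> \<le> (\<Sum>b\<in>P. card b)"
    using assms unfolding partition_on_def
    by (intro sum_mono) (metis One_nat_def Suc_leI Union_upper card_gt_0_iff finite_subset)
  also have "\<dots> = card (\<Union>P)"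
    using assms unfolding partition_on_def
    by (intro card_Union_disjoint[symmetric]) (auto simp: disjoint_def pairwise_def disjnt_def intro: finite_subset)
  finally show ?thesis using assms unfolding partition_on_def by simp
qed

text \<open>Sending each of \<open>1, ..., r\<close> to a block containing it is injective. This
  lower bound allows the number of blocks to be written as \<open>k + r\<close>.\<close>

lemma card_separated_ge:
  assumes "partition_on {1..N} P" "separated r P" "r \<le> N"
  shows "r \<le> card P"
proof -
  have "\<forall>i\<in>{1..r}. \<exists>b\<in>P. i \<in> b"
    using assms(1,3) unfolding partition_on_def by (auto simp: set_eq_iff)
  then obtain g where g: "\<And>i. i \<in> {1..r} \<Longrightarrow> g i \<in> P \<and> i \<in> g i" by metis
  have "inj_on g {1..r}"
    using g assms(2) unfolding separated_def inj_on_def by metis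
  then have "card {1..r} \<le> card P"
    using g assms(1) finite_elements by (intro card_inj_on_le[of g]) auto
  then show ?thesis by simp
qed

theorem theorem5p3:
  fixes r n :: nat
  assumes "r \<ge> 1"
  shows "(\<lambda>k. derangement_number (k + r) * r_stirling r (n + r) (k + r))
           sums card (DUPF r (n + r))"
proof -
  let ?N = "n + r"
  let ?P = "{P. partition_on {1..?N} P \<and> separated r P}"
  let ?h = "\<lambda>k. derangement_number (k + r) * r_stirling r ?N (k + r)"
  have finP: "finite ?P"
    by (rule finite_subset[OF _ finitely_many_partition_on[of "{1..?N}"]]) auto
  have stirling: "r_stirling r ?N K = card {P \<in> ?P. card P = K}" for K
    unfolding r_stirling_def separated_def by (rule arg_cong[of _ _ card]) auto
  have range: "card P \<in> {r..?N}" if "P \<in> ?P" for P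
    using that card_partition_on_le[of "{1..?N}" P] card_separated_ge[of ?N P r] by auto
  have "card (DUPF r ?N) = (\<Sum>P\<in>?P. derangement_number (card P))"
    by (rule card_DUPF) simp
  \<comment> \<open>Partitions are grouped by their number of blocks \<open>K\<close>, which lies
    between \<open>r\<close> and \<open>n + r\<close>.\<close>
  also have "\<dots> = (\<Sum>K\<in>{r..?N}. \<Sum>P\<in>{P \<in> ?P. card P = K}. derangement_number (card P))"
    using finP range by (intro sum.group[symmetric]) auto
  also have "\<dots> = (\<Sum>K\<in>{r..?N}. derangement_number K * r_stirling r ?N K)"
    by (intro sum.cong refl) (simp add: stirling)
  also have "\<dots> = (\<Sum>k\<in>{0..n}. ?h k)"
    using sum.shift_bounds_cl_nat_ivl[of "\<lambda>K. derangement_number K * r_stirling r ?N K" 0 r n]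
    by (simp add: add.commute)
  finally have "card (DUPF r ?N) = (\<Sum>k\<in>{0..n}. ?h k)" .
  \<comment> \<open>For \<open>k > n\<close> a partition would have more blocks than elements, so
    the series has finite support.\<close>
  moreover have "?h k = 0" if "k \<notin> {0..n}" for k
  proof -
    have "{P \<in> ?P. card P = k + r} = {}" using range that by fastforce
    then show ?thesis unfolding stirling by (metis card.empty mult_0_right)
  qed
  ultimately show ?thesis
    using sums_finite[of "{0..n}" ?h] by simp
qed

end
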